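(* Let $\mu\in\mathbb{R}$ and $\sigma^2\ge 0$, let the service rate (in nats) $\mathcal{I}$ be a Gaussian random variable with mean $\mu$ and variance $\sigma^2$, and let $g = e^{\mathcal{I}}$ be the corresponding service process in the exponential (SNR) domain. Then for every $s\in\mathbb{R}$ its Mellin transform is $$\mathcal{M}^{\mathrm{as}}_{g}(s) = e^{(s-1)\mu + (s-1)^2\frac{\sigma^2}{2}}.$$
   Context: The service offered in one time slot is written $\log g$ (rates measured in nats), so a service rate $\mathcal{I}$ corresponds to $g=e^{\mathcal{I}}$. The Mellin transform of a nonnegative random variable $X$ is $\mathcal{M}_X(s)=\mathbb{E}[X^{s-1}]$, considered for real $s$. *)

theory Defs
  imports "HOL-Probability.Probability"
begin

text \<open>
  \<open>normal_density\<close> takes the standard deviation as its parameter and is a probability density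
  only if that is nonzero. Variance \<open>0\<close> is the degenerate Gaussian, i.e. the point mass at the mean.
\<close>

definition gaussian_rv :: "'a measure \<Rightarrow> ('a \<Rightarrow> real) \<Rightarrow> real \<Rightarrow> real \<Rightarrow> bool" where
  "gaussian_rv M X \<mu> v \<longleftrightarrow>
     X \<in> borel_measurable M \<and> 0 \<le> v \<and>
     (if v = 0 then AE \<omega> in M. X \<omega> = \<mu>
      else distributed M lborel X (normal_density \<mu> (sqrt v)))"

lemma (in prob_space) gaussian_rv_moments:
  assumes "gaussian_rv M X \<mu> v"
  shows "expectation X = \<mu>" and "variance X = v"
proof -
  have X: "X \<in> borel_measurable M" and v: "0 \<le> v"
    using assms by (auto simp: gaussian_rv_def)
  have "expectation X = \<mu> \<and> variance X = v"
  proof (cases "v = 0")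
    case True
    then have ae: "AE \<omega> in M. X \<omega> = \<mu>"
      using assms by (simp add: gaussian_rv_def)
    have e: "expectation X = expectation (\<lambda>_. \<mu>)"
      using ae X by (intro integral_cong_AE) auto
    have "variance X = expectation (\<lambda>_. 0)"
      using ae X e by (intro integral_cong_AE) (auto simp: prob_space)
    with e True show ?thesis
      by (simp add: prob_space)
  next
    case False
    then have "distributed M lborel X (normal_density \<mu> (sqrt v))" and "0 < sqrt v"
      using assms v by (auto simp: gaussian_rv_def)
    then show ?thesis
      using normal_distributed_expectation normal_distributed_variance v by fastforce
  qed
  then show "expectation X = \<mu>" and "variance X = v"
    by auto
qed

text \<open>
  Powers of a nonnegative base with values in \<open>[0, \<infinity>]\<close>. Since \<open>0 powr a = 0\<close> for every \<open>a\<close>, the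
  base \<open>0\<close> needs the usual conventions: \<open>0\<close> to the power \<open>0\<close> is \<open>1\<close>, and a negative power of \<open>0\<close> is \<open>\<infinity>\<close>.
\<close>

definition nonneg_powr :: "real \<Rightarrow> real \<Rightarrow> ennreal" where
  "nonneg_powr x a =
     (if x = 0 then (if a = 0 then 1 else if a < 0 then \<infinity> else 0) else ennreal (x powr a))"

text \<open>
  The expectation is taken in \<open>[0, \<infinity>]\<close>, so it always exists for nonnegative \<open>X\<close>, and
  an equation \<open>mellin M X s = ennreal r\<close> includes the finiteness of the moment.
\<close>

definition mellin :: "'a measure \<Rightarrow> ('a \<Rightarrow> real) \<Rightarrow> real \<Rightarrow> ennreal" where
  "mellin M X s = (\<integral>\<^sup>+ \<omega>. nonneg_powr (X \<omega>) (s - 1) \<partial>M)"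

end

theory Submission
  imports Defs
begin

text \<open>
  Completing the square: weighting the Gaussian density by \<open>exp (a * x)\<close> shifts the mean by
  \<open>a * \<sigma>\<^sup>2\<close> and scales the density by the moment generating function at \<open>a\<close>.
\<close>

lemma normal_density_mult_exp:
  assumes "\<sigma> \<noteq> 0"
  shows "normal_density \<mu> \<sigma> x * exp (a * x) =
    exp (a * \<mu> + a\<^sup>2 * (\<sigma>\<^sup>2 / 2)) * normal_density (\<mu> + a * \<sigma>\<^sup>2) \<sigma> x"
proof -
  have "- (x - \<mu>)\<^sup>2 / (2 * \<sigma>\<^sup>2) + a * x =
      (a * \<mu> + a\<^sup>2 * (\<sigma>\<^sup>2 / 2)) + - (x - (\<mu> + a * \<sigma>\<^sup>2))\<^sup>2 / (2 * \<sigma>\<^sup>2)"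
    using assms by (simp add: field_simps power2_eq_square)
  then have "exp (- (x - \<mu>)\<^sup>2 / (2 * \<sigma>\<^sup>2)) * exp (a * x) =
      exp (a * \<mu> + a\<^sup>2 * (\<sigma>\<^sup>2 / 2)) * exp (- (x - (\<mu> + a * \<sigma>\<^sup>2))\<^sup>2 / (2 * \<sigma>\<^sup>2))"
    by (simp only: exp_add [symmetric])
  then show ?thesis
    by (simp add: normal_density_def)
qed

lemma nn_integral_normal_density:
  assumes "0 < \<sigma>"
  shows "(\<integral>\<^sup>+ x. ennreal (normal_density \<mu> \<sigma> x) \<partial>lborel) = 1"
  using prob_space.emeasure_space_1 [OF prob_space_normal_density [OF assms, of \<mu>]]
  by (simp add: emeasure_density)

text \<open>After the square is completed, the constant factor leaves the integral and the remaining
  shifted density has total mass 1. Working in \<open>ennreal\<close> makes finiteness part of the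
  conclusion.\<close>

lemma nn_integral_normal_density_exp:
  assumes "0 < \<sigma>"
  shows "(\<integral>\<^sup>+ x. ennreal (normal_density \<mu> \<sigma> x) * ennreal (exp (a * x)) \<partial>lborel) =
    ennreal (exp (a * \<mu> + a\<^sup>2 * (\<sigma>\<^sup>2 / 2)))"
proof -
  have "ennreal (normal_density \<mu> \<sigma> x) * ennreal (exp (a * x)) =
      ennreal (exp (a * \<mu> + a\<^sup>2 * (\<sigma>\<^sup>2 / 2))) * ennreal (normal_density (\<mu> + a * \<sigma>\<^sup>2) \<sigma> x)" for x
    using normal_density_mult_exp [of \<sigma> \<mu> x a] assms by (simp flip: ennreal_mult)
  then show ?thesis
    by (simp add: nn_integral_cmult nn_integral_normal_density assms)
qed

text \<open>Moment generating function of a Gaussian with variance \<open>v\<close>. The degenerate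
  law has no Lebesgue density, so \<open>v = 0\<close> is treated as a point mass.\<close>

lemma (in prob_space) gaussian_rv_nn_integral_exp:
  assumes "gaussian_rv M X \<mu> v"
  shows "(\<integral>\<^sup>+ \<omega>. ennreal (exp (a * X \<omega>)) \<partial>M) = ennreal (exp (a * \<mu> + a\<^sup>2 * (v / 2)))"
proof (cases "v = 0")
  case True
  then have "AE \<omega> in M. X \<omega> = \<mu>"
    using assms by (simp add: gaussian_rv_def)
  then have "(\<integral>\<^sup>+ \<omega>. ennreal (exp (a * X \<omega>)) \<partial>M) = (\<integral>\<^sup>+ \<omega>. ennreal (exp (a * \<mu>)) \<partial>M)"
    by (intro nn_integral_cong_AE) auto
  \<comment> \<open>The quadratic term vanishes at \<open>v = 0\<close>, and a constant integrates
    to itself over total mass 1.\<close>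
  with True show ?thesis
    by (simp add: emeasure_space_1)
next
  case False
  then have X: "distributed M lborel X (normal_density \<mu> (sqrt v))" and v: "0 < v"
    using assms by (auto simp: gaussian_rv_def)
  have "(\<integral>\<^sup>+ \<omega>. ennreal (exp (a * X \<omega>)) \<partial>M) =
      (\<integral>\<^sup>+ x. ennreal (normal_density \<mu> (sqrt v) x) * ennreal (exp (a * x)) \<partial>lborel)"
    by (rule distributed_nn_integral [OF X, symmetric]) measurable
  \<comment> \<open>Since \<open>0 < v\<close>, the squared standard deviation
    \<open>(sqrt v)\<^sup>2\<close> is \<open>v\<close> again.\<close>
  with v show ?thesis
    by (simp add: nn_integral_normal_density_exp)
qed

text \<open>As \<open>exp\<close> never vanishes, the conventions of \<open>nonneg_powr\<close> at
  base 0 do not arise, and \<open>ln (exp y) = y\<close> turns the power into an exponential. The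
  Mellin transform thus becomes a moment generating function.\<close>

lemma mellin_exp:
  "mellin M (\<lambda>\<omega>. exp (X \<omega>)) s = (\<integral>\<^sup>+ \<omega>. ennreal (exp ((s - 1) * X \<omega>)) \<partial>M)"
  by (simp add: mellin_def nonneg_powr_def powr_def)

theorem theorem4:
  fixes M :: "'a measure"
    and I g :: "'a \<Rightarrow> real"
    and \<mu> \<sigma> :: real
  assumes "prob_space M"
    and "gaussian_rv M I \<mu> (\<sigma>\<^sup>2)"
    and "g = (\<lambda>\<omega>. exp (I \<omega>))"
  shows "\<forall>s::real. mellin M g s = ennreal (exp ((s - 1) * \<mu> + (s - 1)\<^sup>2 * (\<sigma>\<^sup>2 / 2)))"
  \<comment> \<open>The variance is \<sigma> squared, and the argument \<open>a\<close> is taken to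
    be \<open>s - 1\<close>.\<close>
  using prob_space.gaussian_rv_nn_integral_exp [OF assms(1,2)]
  by (simp add: assms(3) mellin_exp)

end
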